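(* Let $H$ be a non-empty connected hypergraph (non-empty meaning that $H$ has at least one edge) with a minimal edge cut $F$. Let $H_i$, for $i\in I$, be the connected components of $H\setminus F$. For a function $\alpha:F\to\{ij: i,j\in I\}$ (where $ij$ denotes an unordered pair and $i=j$ is allowed), let $G_\alpha$ be the multigraph (loops and parallel edges allowed) with vertex set $I$ in which, for all $i,j\in I$, the multiplicity of the edge $ij$ is $|\alpha^{-1}(ij)|$. For each connected component $C$ of $G_\alpha$, let $$H(C)=\Big(\bigcup_{i\in V(C)}H_i\Big)+\Big\{f\cap\Big(\bigcup_{i\in V(C)}V(H_i)\Big): f\in\alpha^{-1}(E(C))\Big\}.$$ Then $H$ has an Euler family $\mathcal{F}$ if and only if there exists a function $\alpha:F\to\{ij:i,j\in I\}$ such that, for each connected component $C$ of $G_\alpha$, the hypergraph $H(C)$ has an Euler family $\mathcal{F}_C$. Likewise, $H$ has a spanning Euler family $\mathcal{F}$ if and only if there exists such an $\alpha$ for which every $H(C)$ has a spanning Euler family $\mathcal{F}_C$. Furthermore, if $\mathcal{C}$ denotes the collection of connected components of $G_\alpha$, then these Euler families can be chosen to satisfy $|\mathcal{F}|=\sum_{C\in\mathcal{C}}|\mathcal{F}_C|$.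
   Context: A hypergraph $H=(V,E)$ has a non-empty finite vertex set $V$ and a finite collection $E$ of edges, each associated with a subset of $V$; parallel edges are allowed, so $E$ is a multiset of subsets of $V$. A walk is a sequence $v_0e_1v_1\dots v_{r-1}e_rv_r$ ($r\ge 0$) with $v_{i-1}\ne v_i$ and $v_{i-1},v_i\in e_i$ for all $i=1,\dots,r$; its anchors are $v_0,\dots,v_r$; it is closed if $v_0=v_r$, trivial if $r=0$, and a strict trail if its edges are pairwise distinct. $H$ is connected if any two vertices are joined by a walk; the connected components of $H$ are its maximal connected subhypergraphs $(V',E')$ with $V'\subseteq V$, $E'\subseteq E$, having no empty edges. An Euler family of $H$ is a collection of pairwise edge-disjoint, pairwise anchor-disjoint non-trivial closed strict trails of $H$ jointly traversing every edge of $H$ exactly once (an edgeless hypergraph has the empty Euler family); it is spanning if every vertex of $H$ is an anchor of one of its trails. For $\emptyset\neq S\subsetneq V$, the set $[S,\overline S]=\{e\in E: e\cap S\neq\emptyset,\ e\cap\overline S\neq\emptyset\}$, with $\overline S=V\setminus S$, is an edge cut of $H$; an edge cut is minimal if it properly contains no edge cut of $H$. $H\setminus F=(V,E\setminus F)$. Unions of (vertex-disjoint) hypergraphs take the union of vertex sets and of edge multisets. $H'+E'$ denotes the hypergraph obtained from $H'$ by adjoining a new copy of each member of the multiset $E'$; above, one new edge is adjoined for each $f\in\alpha^{-1}(E(C))$, where $\alpha^{-1}(E(C))$ is the set of $f\in F$ such that $\alpha(f)$ is an edge of $C$.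
   Formalization: H is additionally assumed to have no empty edges; otherwise the "if" direction fails, e.g. for V={u,v} with two parallel edges {u,v} forming F and one empty edge, which belongs to no H(C) and cannot be traversed. *)

theory Defs
  imports Main "HOL-Library.FuncSet"
begin

(* Edges carry labels of type 'e, and a label is mapped to the vertex subset it stands for;
   two labels with the same vertex subset are parallel edges.  The value of the incidence
   map on labels outside the edge set is irrelevant. *)
record ('v, 'e) hypergraph =
  hverts :: "'v set"
  hedges :: "'e set"
  hends  :: "'e \<Rightarrow> 'v set"

definition is_hypergraph :: "('v, 'e) hypergraph \<Rightarrow> bool" where
  "is_hypergraph H \<longleftrightarrow>
     finite (hverts H) \<and> hverts H \<noteq> {} \<and> finite (hedges H) \<and>
     (\<forall>e\<in>hedges H. hends H e \<subseteq> hverts H)"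

definition no_empty_edges :: "('v, 'e) hypergraph \<Rightarrow> bool" where
  "no_empty_edges H \<longleftrightarrow> (\<forall>e\<in>hedges H. hends H e \<noteq> {})"

(* The sequence v0 e1 v1 ... er vr is the pair ([v0, ..., vr], [e1, ..., er]). *)
type_synonym ('v, 'e) hwalk = "'v list \<times> 'e list"

definition anchors :: "('v, 'e) hwalk \<Rightarrow> 'v set" where
  "anchors T = set (fst T)"

definition walk_edges :: "('v, 'e) hwalk \<Rightarrow> 'e set" where
  "walk_edges T = set (snd T)"

definition is_walk :: "('v, 'e) hypergraph \<Rightarrow> ('v, 'e) hwalk \<Rightarrow> bool" where
  "is_walk H T \<longleftrightarrow> (case T of (vs, es) \<Rightarrow>
     length vs = Suc (length es) \<and> set vs \<subseteq> hverts H \<and> set es \<subseteq> hedges H \<and>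
     (\<forall>i<length es. vs ! i \<noteq> vs ! Suc i \<and>
        vs ! i \<in> hends H (es ! i) \<and> vs ! Suc i \<in> hends H (es ! i)))"

definition closed_walk :: "('v, 'e) hwalk \<Rightarrow> bool" where
  "closed_walk T \<longleftrightarrow> hd (fst T) = last (fst T)"

definition trivial_walk :: "('v, 'e) hwalk \<Rightarrow> bool" where
  "trivial_walk T \<longleftrightarrow> snd T = []"

definition strict_trail :: "('v, 'e) hypergraph \<Rightarrow> ('v, 'e) hwalk \<Rightarrow> bool" where
  "strict_trail H T \<longleftrightarrow> is_walk H T \<and> distinct (snd T)"

definition hconnected :: "('v, 'e) hypergraph \<Rightarrow> bool" where
  "hconnected H \<longleftrightarrow> (\<forall>u\<in>hverts H. \<forall>v\<in>hverts H.
     \<exists>T. is_walk H T \<and> hd (fst T) = u \<and> last (fst T) = v)"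

(* The incidence map is inherited unchanged, so a subhypergraph is determined by its
   vertex set and its edge set. *)
definition subhypergraph :: "('v, 'e) hypergraph \<Rightarrow> ('v, 'e) hypergraph \<Rightarrow> bool" where
  "subhypergraph K H \<longleftrightarrow> is_hypergraph K \<and>
     hverts K \<subseteq> hverts H \<and> hedges K \<subseteq> hedges H \<and> hends K = hends H"

definition hcomponents :: "('v, 'e) hypergraph \<Rightarrow> ('v, 'e) hypergraph set" where
  "hcomponents H = {K. subhypergraph K H \<and> hconnected K \<and> no_empty_edges K \<and>
     (\<forall>K'. subhypergraph K' H \<and> hconnected K' \<and> no_empty_edges K' \<and> subhypergraph K K'
        \<longrightarrow> K' = K)}"

(* That each edge is traversed exactly once is expressed by strictness of the trails,
   their pairwise edge-disjointness, and the last conjunct. *)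
definition euler_family :: "('v, 'e) hypergraph \<Rightarrow> ('v, 'e) hwalk set \<Rightarrow> bool" where
  "euler_family H \<F> \<longleftrightarrow>
     (\<forall>T\<in>\<F>. strict_trail H T \<and> closed_walk T \<and> \<not> trivial_walk T) \<and>
     (\<forall>T\<in>\<F>. \<forall>T'\<in>\<F>. T \<noteq> T' \<longrightarrow>
        walk_edges T \<inter> walk_edges T' = {} \<and> anchors T \<inter> anchors T' = {}) \<and>
     (\<Union>T\<in>\<F>. walk_edges T) = hedges H"

definition spanning_euler_family :: "('v, 'e) hypergraph \<Rightarrow> ('v, 'e) hwalk set \<Rightarrow> bool" where
  "spanning_euler_family H \<F> \<longleftrightarrow>
     euler_family H \<F> \<and> (\<forall>v\<in>hverts H. \<exists>T\<in>\<F>. v \<in> anchors T)"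

definition cut_edges :: "('v, 'e) hypergraph \<Rightarrow> 'v set \<Rightarrow> 'e set" where
  "cut_edges H S =
     {e\<in>hedges H. hends H e \<inter> S \<noteq> {} \<and> hends H e \<inter> (hverts H - S) \<noteq> {}}"

definition edge_cut :: "('v, 'e) hypergraph \<Rightarrow> 'e set \<Rightarrow> bool" where
  "edge_cut H F \<longleftrightarrow> (\<exists>S. S \<noteq> {} \<and> S \<subset> hverts H \<and> F = cut_edges H S)"

definition minimal_edge_cut :: "('v, 'e) hypergraph \<Rightarrow> 'e set \<Rightarrow> bool" where
  "minimal_edge_cut H F \<longleftrightarrow> edge_cut H F \<and> \<not> (\<exists>F'. edge_cut H F' \<and> F' \<subset> F)"

definition delete_edges :: "('v, 'e) hypergraph \<Rightarrow> 'e set \<Rightarrow> ('v, 'e) hypergraph" where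
  "delete_edges H F = \<lparr>hverts = hverts H, hedges = hedges H - F, hends = hends H\<rparr>"

(* Meant for families whose members have pairwise disjoint sets of edge labels: the inner
   union then picks the vertex subset of e in the one member that contains e. *)
definition hyper_Union :: "'i set \<Rightarrow> ('i \<Rightarrow> ('v, 'e) hypergraph) \<Rightarrow> ('v, 'e) hypergraph" where
  "hyper_Union J K =
     \<lparr>hverts = (\<Union>i\<in>J. hverts (K i)),
      hedges = (\<Union>i\<in>J. hedges (K i)),
      hends = (\<lambda>e. \<Union>i\<in>{i\<in>J. e \<in> hedges (K i)}. hends (K i) e)\<rparr>"

(* Adds one edge for each label f in A, standing for the vertex subset g f.  The edges are
   new provided that A is disjoint from the edge labels of H. *)
definition adjoin_edges ::
  "('v, 'e) hypergraph \<Rightarrow> 'e set \<Rightarrow> ('e \<Rightarrow> 'v set) \<Rightarrow> ('v, 'e) hypergraph" where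
  "adjoin_edges H A g =
     \<lparr>hverts = hverts H, hedges = hedges H \<union> A,
      hends = (\<lambda>e. if e \<in> A then g e else hends H e)\<rparr>"

(* The unordered pair ij is the set {i, j}, a singleton if i = j. *)
definition unordered_pairs :: "'i set \<Rightarrow> 'i set set" where
  "unordered_pairs I = {{i, j} | i j. i \<in> I \<and> j \<in> I}"

(* A multigraph is a hypergraph all of whose edges are unordered pairs of vertices, loops
   being the one-element edges.  The copies of the edge ij are labelled by the f in F with
   \<alpha> f = {i, j}. *)
definition cut_multigraph :: "'i set \<Rightarrow> 'e set \<Rightarrow> ('e \<Rightarrow> 'i set) \<Rightarrow> ('i, 'e) hypergraph" where
  "cut_multigraph I F \<alpha> = \<lparr>hverts = I, hedges = F, hends = \<alpha>\<rparr>"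

definition preimage_edges ::
  "'e set \<Rightarrow> ('e \<Rightarrow> 'i set) \<Rightarrow> ('i, 'e) hypergraph \<Rightarrow> 'e set" where
  "preimage_edges F \<alpha> C = {f\<in>F. \<alpha> f \<in> hends C ` hedges C}"

definition component_hypergraph ::
  "('v, 'e) hypergraph \<Rightarrow> 'e set \<Rightarrow> ('i \<Rightarrow> ('v, 'e) hypergraph) \<Rightarrow> ('e \<Rightarrow> 'i set)
     \<Rightarrow> ('i, 'e) hypergraph \<Rightarrow> ('v, 'e) hypergraph" where
  "component_hypergraph H F K \<alpha> C =
     adjoin_edges (hyper_Union (hverts C) K) (preimage_edges F \<alpha> C)
       (\<lambda>f. hends H f \<inter> (\<Union>i\<in>hverts C. hverts (K i)))"

end

theory Submission imports Defs begin

text \<open>For an assignment \<open>\<alpha>\<close>, the components \<open>C\<close> of the multigraph \<open>G\<^sub>\<alpha>\<close> partition the index set,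
  so the hypergraphs \<open>H(C)\<close> partition the vertices of \<open>H\<close>. They also partition its edges: an edge
  outside the cut lies in exactly one \<open>H\<^sub>i\<close>, and a cut edge \<open>f\<close> goes to the component of \<open>G\<^sub>\<alpha>\<close> that
  contains the edge \<open>\<alpha> f\<close>. A cut edge may lose some ends when it is cut down to \<open>V(H(C))\<close>, but a
  walk only needs the two anchors next to the edge to be among its ends. Hence the trails of
  \<open>H(C)\<close> are exactly the trails of \<open>H\<close> whose anchors and edges all lie in \<open>H(C)\<close>
  (\<open>strict_trail_part_iff\<close>).

  From \<open>H(C)\<close> to \<open>H\<close>, it follows that the union of Euler families of all the \<open>H(C)\<close> is an Euler
  family of \<open>H\<close>; the union is disjoint because non-trivial trails have edges, so the numbers of
  trails add up, and it is spanning if all members are (\<open>euler_family_Union\<close>,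
  \<open>spanning_euler_family_Union\<close>).

  From \<open>H\<close> to \<open>H(C)\<close>, an Euler family traverses each cut edge \<open>f\<close> once, between two anchors in
  some \<open>H\<^sub>i\<close> and \<open>H\<^sub>j\<close>; put \<open>\<alpha> f = ij\<close>. Along a trail, the index of the current anchor changes
  only at cut edges, and then along an edge of \<open>G\<^sub>\<alpha>\<close>. So each trail stays in a single \<open>H(C)\<close>
  (\<open>trail_in_part\<close>), and the Euler family splits into Euler families of the \<open>H(C)\<close>
  (\<open>euler_family_splits\<close>).\<close>

section \<open>Connected components\<close>

definition adjacency :: "('v, 'e) hypergraph \<Rightarrow> ('v \<times> 'v) set" where
  "adjacency H = {(u, v). u \<in> hverts H \<and> v \<in> hverts H \<and>
     (\<exists>e\<in>hedges H. u \<in> hends H e \<and> v \<in> hends H e)}"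

text \<open>Connectedness is handled through the reflexive transitive closure of adjacency, which makes
  it easy to glue connected pieces; the next two lemmas justify this. A walk must change its
  anchor at each step while adjacency is reflexive on vertices that lie in an edge, so steps that stay in
  place are dropped when a walk is built.\<close>

lemma walk_imp_reachable:
  assumes "is_walk H T"
  shows "(hd (fst T), last (fst T)) \<in> (adjacency H)\<^sup>*"
proof -
  obtain vs es where T: "T = (vs, es)" by fastforce
  have len: "length vs = Suc (length es)" and vs: "set vs \<subseteq> hverts H" and es: "set es \<subseteq> hedges H"
    and step: "\<And>k. k < length es \<Longrightarrow> vs ! k \<in> hends H (es ! k) \<and> vs ! Suc k \<in> hends H (es ! k)"
    using assms unfolding T is_walk_def by auto
  have "(vs ! 0, vs ! k) \<in> (adjacency H)\<^sup>*" if "k \<le> length es" for k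
    using that
  proof (induction k)
    case (Suc k)
    have "vs ! k \<in> hverts H" "vs ! Suc k \<in> hverts H" "es ! k \<in> hedges H"
      using vs es len Suc.prems nth_mem[of k vs] nth_mem[of "Suc k" vs] nth_mem[of k es] by auto
    with step[of k] Suc.prems have "(vs ! k, vs ! Suc k) \<in> adjacency H"
      unfolding adjacency_def by auto
    with Suc show ?case by (auto intro: rtrancl_into_rtrancl)
  qed simp
  moreover have "vs \<noteq> []" using len by auto
  ultimately show ?thesis
    using len by (simp add: T hd_conv_nth last_conv_nth)
qed

lemma reachable_imp_walk:
  assumes "(u, v) \<in> (adjacency H)\<^sup>*" and "u \<in> hverts H"
  shows "\<exists>T. is_walk H T \<and> hd (fst T) = u \<and> last (fst T) = v"
  using assms(1)
proof (induction rule: rtrancl_induct)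
  case base
  have "is_walk H ([u], [])" using assms(2) by (simp add: is_walk_def)
  then show ?case by force
next
  case (step v w)
  then obtain vs es where T: "is_walk H (vs, es)" "hd vs = u" "last vs = v" by auto
  then have vs: "vs \<noteq> []" "length vs = Suc (length es)" by (auto simp: is_walk_def)
  show ?case
  proof (cases "v = w")
    case True
    with T show ?thesis by auto
  next
    case False
    from step.hyps obtain e where e: "e \<in> hedges H" "v \<in> hends H e" "w \<in> hends H e" "w \<in> hverts H"
      unfolding adjacency_def by auto
    have "vs ! length es = v" using T(3) vs by (simp add: last_conv_nth)
    then have "is_walk H (vs @ [w], es @ [e])"
      using T(1) e False vs(2) by (auto simp: is_walk_def nth_append less_Suc_eq)
    then show ?thesis using T vs by (intro exI[of _ "(vs @ [w], es @ [e])"]) auto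
  qed
qed

lemma hconnected_iff_reachable:
  "hconnected H \<longleftrightarrow> (\<forall>u\<in>hverts H. \<forall>v\<in>hverts H. (u, v) \<in> (adjacency H)\<^sup>*)"
  unfolding hconnected_def by (metis walk_imp_reachable reachable_imp_walk)

lemma hconnectedI:
  assumes "\<And>u. u \<in> hverts H \<Longrightarrow> (w, u) \<in> (adjacency H)\<^sup>*"
  shows "hconnected H"
proof -
  have "sym ((adjacency H)\<^sup>*)" by (rule sym_rtrancl) (auto simp: sym_def adjacency_def)
  with assms show ?thesis
    unfolding hconnected_iff_reachable by (meson rtrancl_trans symD)
qed

lemma reachable_mono:
  assumes "(u, v) \<in> (adjacency K)\<^sup>*"
    and "hverts K \<subseteq> hverts L" "hedges K \<subseteq> hedges L" "hends K = hends L"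
  shows "(u, v) \<in> (adjacency L)\<^sup>*"
proof -
  have "adjacency K \<subseteq> adjacency L" using assms(2-4) by (auto simp: adjacency_def)
  with assms(1) show ?thesis using rtrancl_mono by blast
qed

lemma component_maximal:
  assumes "K \<in> hcomponents H" "subhypergraph K' H" "hconnected K'" "no_empty_edges K'"
    and "hverts K \<subseteq> hverts K'" "hedges K \<subseteq> hedges K'"
  shows "K' = K"
  using assms unfolding hcomponents_def subhypergraph_def by auto

text \<open>A component can be enlarged by any connected part that shares a vertex with it, so by
  maximality it already contains that part.\<close>

lemma component_absorbs:
  assumes K: "K \<in> hcomponents H"
    and L: "subhypergraph L H" "hconnected L" "no_empty_edges L"
    and w: "w \<in> hverts K" "w \<in> hverts L"
  shows "hverts L \<subseteq> hverts K \<and> hedges L \<subseteq> hedges K"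
proof -
  let ?U = "\<lparr>hverts = hverts K \<union> hverts L, hedges = hedges K \<union> hedges L, hends = hends H\<rparr>"
  have K': "subhypergraph K H" "hconnected K" "no_empty_edges K"
    using K by (auto simp: hcomponents_def)
  have sub: "subhypergraph ?U H"
    using K'(1) L(1) by (fastforce simp: subhypergraph_def is_hypergraph_def)
  have ne: "no_empty_edges ?U"
    using K' L by (auto simp: subhypergraph_def no_empty_edges_def)
  have "hconnected ?U"
  proof (rule hconnectedI[of _ w])
    fix u assume "u \<in> hverts ?U"
    then consider "u \<in> hverts K" | "u \<in> hverts L" by auto
    then show "(w, u) \<in> (adjacency ?U)\<^sup>*"
    proof cases
      case 1
      then have "(w, u) \<in> (adjacency K)\<^sup>*" using K'(2) w by (simp add: hconnected_iff_reachable)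
      then show ?thesis using K'(1) by (elim reachable_mono) (auto simp: subhypergraph_def)
    next
      case 2
      then have "(w, u) \<in> (adjacency L)\<^sup>*" using L(2) w by (simp add: hconnected_iff_reachable)
      then show ?thesis using L(1) by (elim reachable_mono) (auto simp: subhypergraph_def)
    qed
  qed
  then have "?U = K" using component_maximal[OF K sub _ ne] by simp
  then have "hverts ?U = hverts K" "hedges ?U = hedges K" by (simp_all only:)
  then show ?thesis by auto
qed

lemma components_disjoint:
  assumes "K \<in> hcomponents H" "L \<in> hcomponents H" "w \<in> hverts K" "w \<in> hverts L"
  shows "K = L"
proof -
  have L: "subhypergraph L H" "hconnected L" "no_empty_edges L"
    using assms(2) by (auto simp: hcomponents_def)
  have "hverts L \<subseteq> hverts K" "hedges L \<subseteq> hedges K"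
    using component_absorbs[OF assms(1) L assms(3,4)] by auto
  moreover have "subhypergraph K H" "hconnected K" "no_empty_edges K"
    using assms(1) by (auto simp: hcomponents_def)
  ultimately show ?thesis using component_maximal[OF assms(2)] by blast
qed

text \<open>An edge together with its ends is a connected part.\<close>

lemma edge_in_component:
  assumes H: "is_hypergraph H" and K: "K \<in> hcomponents H"
    and e: "e \<in> hedges H" and w: "w \<in> hends H e" "w \<in> hverts K"
  shows "e \<in> hedges K"
proof -
  let ?L = "\<lparr>hverts = hends H e, hedges = {e}, hends = hends H\<rparr>"
  have "subhypergraph ?L H"
    using H e w by (auto simp: subhypergraph_def is_hypergraph_def intro: finite_subset)
  moreover have "hconnected ?L"
    using w by (intro hconnectedI[of _ w] r_into_rtrancl) (auto simp: adjacency_def)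
  moreover have "no_empty_edges ?L" using w by (auto simp: no_empty_edges_def)
  ultimately have "hedges ?L \<subseteq> hedges K" using component_absorbs[OF K] w
    by (metis hypergraph.select_convs(1))
  then show ?thesis by simp
qed

lemma component_edge_ends:
  assumes "K \<in> hcomponents H" "e \<in> hedges K"
  shows "hends H e \<subseteq> hverts K" "hends H e \<noteq> {}" "e \<in> hedges H"
proof -
  have K: "hends K = hends H" "is_hypergraph K" "no_empty_edges K" "hedges K \<subseteq> hedges H"
    using assms(1) by (auto simp: hcomponents_def subhypergraph_def)
  show "hends H e \<subseteq> hverts K" "hends H e \<noteq> {}" "e \<in> hedges H"
    using K assms(2) by (auto simp: is_hypergraph_def no_empty_edges_def)
qed

lemma component_verts:
  assumes "K \<in> hcomponents H"
  shows "hverts K \<subseteq> hverts H" "hverts K \<noteq> {}" "hends K = hends H"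
  using assms unfolding hcomponents_def subhypergraph_def is_hypergraph_def by auto

text \<open>The component of a vertex is a connected part containing it of largest size; finiteness
  of the hypergraph bounds the size.\<close>

lemma vertex_in_component:
  assumes H: "is_hypergraph H" and v: "v \<in> hverts H"
  obtains K where "K \<in> hcomponents H" "v \<in> hverts K"
proof -
  define P where "P K \<longleftrightarrow> subhypergraph K H \<and> hconnected K \<and> no_empty_edges K \<and> v \<in> hverts K" for K
  define m where "m K = card (hverts K) + card (hedges K)" for K :: "('a, 'b) hypergraph"
  have "P \<lparr>hverts = {v}, hedges = {}, hends = hends H\<rparr>"
    using v by (auto simp: P_def subhypergraph_def is_hypergraph_def no_empty_edges_def
        intro: hconnectedI[of _ v])
  moreover have bound: "m K < Suc (m H)" if "P K" for K
    using that H by (auto simp: P_def m_def subhypergraph_def is_hypergraph_def less_Suc_eq_le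
        intro!: add_mono card_mono)
  ultimately obtain K where K: "P K" and max: "\<And>K'. P K' \<Longrightarrow> m K' \<le> m K"
    using ex_has_greatest_nat[of P _ m "Suc (m H)"] by (metis less_imp_le)
  have "K' = K"
    if K': "subhypergraph K' H" "hconnected K'" "no_empty_edges K'" "subhypergraph K K'" for K'
  proof -
    have sub: "hverts K \<subseteq> hverts K'" "hedges K \<subseteq> hedges K'" "hends K' = hends K"
      using K'(4) by (auto simp: subhypergraph_def)
    have fin: "finite (hverts K')" "finite (hedges K')"
      using K'(1) by (auto simp: subhypergraph_def is_hypergraph_def)
    have "P K'" using K' K sub by (auto simp: P_def)
    then have "card (hverts K') + card (hedges K') \<le> card (hverts K) + card (hedges K)"
      using max by (simp add: m_def)
    moreover have "card (hverts K) \<le> card (hverts K')" "card (hedges K) \<le> card (hedges K')"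
      using sub fin by (auto intro: card_mono)
    ultimately have "hverts K = hverts K'" "hedges K = hedges K'"
      using card_subset_eq[OF fin(1) sub(1)] card_subset_eq[OF fin(2) sub(2)] by linarith+
    with sub(3) show ?thesis by simp
  qed
  with K have "K \<in> hcomponents H" "v \<in> hverts K" by (auto simp: hcomponents_def P_def)
  with that show ?thesis by blast
qed

lemma finite_hcomponents:
  assumes "is_hypergraph H"
  shows "finite (hcomponents H)"
proof (rule inj_on_finite)
  show "inj_on hverts (hcomponents H)"
    using components_disjoint component_verts(2) by (metis equals0I inj_onI)
  show "hverts ` hcomponents H \<subseteq> Pow (hverts H)" using component_verts(1) by fastforce
  show "finite (Pow (hverts H))" using assms by (simp add: is_hypergraph_def)
qed

section \<open>Euler families of a hypergraph cut into parts\<close>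

text \<open>An abstract form of the family of the \<open>H(C)\<close>, which separates the combination of Euler
  families from the way in which the parts arise. An edge of a part may have fewer ends than in
  the whole, so the parts need not be subhypergraphs.\<close>

locale hypergraph_parts =
  fixes H :: "('v, 'e) hypergraph" and J :: "'j set" and L :: "'j \<Rightarrow> ('v, 'e) hypergraph"
  assumes finite_edges: "finite (hedges H)"
    and finite_parts: "finite J"
    and verts_Union: "hverts H = (\<Union>c\<in>J. hverts (L c))"
    and edges_Union: "hedges H = (\<Union>c\<in>J. hedges (L c))"
    and verts_disjoint: "\<lbrakk>c \<in> J; d \<in> J; v \<in> hverts (L c); v \<in> hverts (L d)\<rbrakk> \<Longrightarrow> c = d"
    and edges_disjoint: "\<lbrakk>c \<in> J; d \<in> J; e \<in> hedges (L c); e \<in> hedges (L d)\<rbrakk> \<Longrightarrow> c = d"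
    and ends_part: "\<lbrakk>c \<in> J; e \<in> hedges (L c)\<rbrakk> \<Longrightarrow> hends (L c) e = hends H e \<inter> hverts (L c)"
begin

text \<open>The truncation of edges does no harm: the anchors next to an edge of such a trail lie in the
  part, so they are among the ends that the edge keeps there.\<close>

lemma strict_trail_part_iff:
  assumes "c \<in> J"
  shows "strict_trail (L c) T \<longleftrightarrow>
    strict_trail H T \<and> anchors T \<subseteq> hverts (L c) \<and> walk_edges T \<subseteq> hedges (L c)"
proof -
  obtain vs es where T: "T = (vs, es)" by fastforce
  have "hends (L c) (es ! k) = hends H (es ! k) \<inter> hverts (L c)"
    if "k < length es" "set es \<subseteq> hedges (L c)" for k
    using that ends_part[OF assms] nth_mem by blast
  moreover have "vs ! k \<in> hverts (L c)" if "k < length vs" "set vs \<subseteq> hverts (L c)" for k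
    using that nth_mem by blast
  moreover have "hverts (L c) \<subseteq> hverts H" "hedges (L c) \<subseteq> hedges H"
    using assms verts_Union edges_Union by auto
  ultimately show ?thesis
    unfolding T strict_trail_def is_walk_def anchors_def walk_edges_def by auto
qed

text \<open>Distinct trails of the family have disjoint non-empty edge sets, so a trail is determined by
  its edge set.\<close>

lemma finite_euler_family:
  assumes "euler_family H \<F>"
  shows "finite \<F>"
proof (rule inj_on_finite)
  show "inj_on walk_edges \<F>"
  proof (rule inj_onI)
    fix T T' assume "T \<in> \<F>" "T' \<in> \<F>" "walk_edges T = walk_edges T'"
    moreover from this have "walk_edges T \<noteq> {}"
      using assms by (auto simp: euler_family_def trivial_walk_def walk_edges_def)
    ultimately show "T = T'" using assms unfolding euler_family_def by (metis inf.idem)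
  qed
  show "walk_edges ` \<F> \<subseteq> Pow (hedges H)" using assms by (auto simp: euler_family_def)
  show "finite (Pow (hedges H))" using finite_edges by simp
qed

lemma euler_family_Union:
  assumes "\<And>c. c \<in> J \<Longrightarrow> euler_family (L c) (\<G> c)"
  shows "euler_family H (\<Union>c\<in>J. \<G> c)" "card (\<Union>c\<in>J. \<G> c) = (\<Sum>c\<in>J. card (\<G> c))"
proof -
  have part: "anchors T \<subseteq> hverts (L c)" "walk_edges T \<subseteq> hedges (L c)" "strict_trail H T"
    "closed_walk T" "\<not> trivial_walk T" if "c \<in> J" "T \<in> \<G> c" for c T
    using that assms strict_trail_part_iff by (auto simp: euler_family_def)
  have edges: "(\<Union>T\<in>\<G> c. walk_edges T) = hedges (L c)" if "c \<in> J" for c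
    using that assms by (simp add: euler_family_def)
  have disj: "walk_edges T \<inter> walk_edges T' = {} \<and> anchors T \<inter> anchors T' = {}"
    if "c \<in> J" "d \<in> J" "T \<in> \<G> c" "T' \<in> \<G> d" "T \<noteq> T'" for c d T T'
  proof (cases "c = d")
    case True
    then show ?thesis using that assms[of c] by (auto simp: euler_family_def)
  next
    case False
    then show ?thesis
      using that part(1,2) verts_disjoint edges_disjoint by (meson disjoint_iff subsetD)
  qed
  show euler: "euler_family H (\<Union>c\<in>J. \<G> c)"
    unfolding euler_family_def
  proof (intro conjI)
    show "(\<Union>T\<in>(\<Union>c\<in>J. \<G> c). walk_edges T) = hedges H" using edges edges_Union by auto
  qed (use part disj in auto)
  have "finite (\<G> c)" if "c \<in> J" for c
    by (rule finite_subset[OF _ finite_euler_family[OF euler]]) (use that in auto)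
  moreover have "\<G> c \<inter> \<G> d = {}" if "c \<in> J" "d \<in> J" "c \<noteq> d" for c d
  proof (rule ccontr)
    assume "\<G> c \<inter> \<G> d \<noteq> {}"
    then obtain T where T: "T \<in> \<G> c" "T \<in> \<G> d" by auto
    moreover have "walk_edges T \<noteq> {}"
      using part(5)[OF \<open>c \<in> J\<close> T(1)] by (simp add: trivial_walk_def walk_edges_def)
    ultimately show False using that part(2) edges_disjoint by blast
  qed
  ultimately show "card (\<Union>c\<in>J. \<G> c) = (\<Sum>c\<in>J. card (\<G> c))"
    using finite_parts by (intro card_UN_disjoint) auto
qed

lemma spanning_euler_family_Union:
  assumes "\<And>c. c \<in> J \<Longrightarrow> spanning_euler_family (L c) (\<G> c)"
  shows "spanning_euler_family H (\<Union>c\<in>J. \<G> c)"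
proof -
  have "euler_family H (\<Union>c\<in>J. \<G> c)"
    using euler_family_Union assms by (auto simp: spanning_euler_family_def)
  moreover have "\<exists>T\<in>(\<Union>c\<in>J. \<G> c). v \<in> anchors T" if "v \<in> hverts H" for v
    using that verts_Union assms by (fastforce simp: spanning_euler_family_def)
  ultimately show ?thesis by (simp add: spanning_euler_family_def)
qed

definition part_trails :: "('v, 'e) hwalk set \<Rightarrow> 'j \<Rightarrow> ('v, 'e) hwalk set" where
  "part_trails \<F> c = {T\<in>\<F>. anchors T \<subseteq> hverts (L c) \<and> walk_edges T \<subseteq> hedges (L c)}"

text \<open>Conversely, an Euler family each of whose trails stays in one part splits into Euler families
  of the parts: an edge or vertex of a part is only traversed, or an anchor, in trails of that same part.\<close>

context
  fixes \<F>
  assumes euler: "euler_family H \<F>"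
    and in_part: "\<And>T. T \<in> \<F> \<Longrightarrow>
      \<exists>c\<in>J. anchors T \<subseteq> hverts (L c) \<and> walk_edges T \<subseteq> hedges (L c)"
begin

lemma euler_family_part:
  assumes "c \<in> J"
  shows "euler_family (L c) (part_trails \<F> c)"
  unfolding euler_family_def
proof (intro conjI)
  show "(\<Union>T\<in>part_trails \<F> c. walk_edges T) = hedges (L c)"
  proof (intro equalityI subsetI)
    fix e assume e: "e \<in> hedges (L c)"
    then have "e \<in> hedges H" using assms edges_Union by auto
    then obtain T where T: "T \<in> \<F>" "e \<in> walk_edges T"
      using euler unfolding euler_family_def by blast
    then obtain d where d: "d \<in> J" "anchors T \<subseteq> hverts (L d)" "walk_edges T \<subseteq> hedges (L d)"
      using in_part by blast
    then have "d = c" using edges_disjoint e T(2) assms by blast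
    with d T show "e \<in> (\<Union>T\<in>part_trails \<F> c. walk_edges T)"
      unfolding part_trails_def by blast
  qed (auto simp: part_trails_def)
qed (use euler strict_trail_part_iff[OF assms] in \<open>auto simp: euler_family_def part_trails_def\<close>)

lemma part_trails_Union: "(\<Union>c\<in>J. part_trails \<F> c) = \<F>"
  using in_part by (auto simp: part_trails_def)

text \<open>The trails of the parts are put together again, so that the count is the one made for
  unions.\<close>

lemma card_part_trails: "card \<F> = (\<Sum>c\<in>J. card (part_trails \<F> c))"
  using euler_family_Union(2)[of "part_trails \<F>"] euler_family_part part_trails_Union by simp

lemma spanning_euler_family_part:
  assumes "c \<in> J" "spanning_euler_family H \<F>"
  shows "spanning_euler_family (L c) (part_trails \<F> c)"
proof -
  have "\<exists>T\<in>part_trails \<F> c. v \<in> anchors T" if v: "v \<in> hverts (L c)" for v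
  proof -
    have "v \<in> hverts H" using v assms(1) verts_Union by auto
    then obtain T where T: "T \<in> \<F>" "v \<in> anchors T"
      using assms(2) by (auto simp: spanning_euler_family_def)
    then obtain d where d: "d \<in> J" "anchors T \<subseteq> hverts (L d)" "walk_edges T \<subseteq> hedges (L d)"
      using in_part by blast
    then have "d = c" using verts_disjoint v T(2) assms(1) by blast
    with d T show ?thesis unfolding part_trails_def by blast
  qed
  with euler_family_part[OF assms(1)] show ?thesis by (simp add: spanning_euler_family_def)
qed

end

end

section \<open>The parts given by an assignment of the cut edges\<close>

locale deleted_edges =
  fixes H :: "('v, 'e) hypergraph" and F :: "'e set"
    and I :: "'i set" and K :: "'i \<Rightarrow> ('v, 'e) hypergraph"
  assumes hyp: "is_hypergraph H" and ne: "no_empty_edges H" and F_edges: "F \<subseteq> hedges H"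
    and bij: "bij_betw K I (hcomponents (delete_edges H F))"
begin

lemma is_hypergraph_delete: "is_hypergraph (delete_edges H F)"
  using hyp by (auto simp: is_hypergraph_def delete_edges_def)

lemma K_component: "i \<in> I \<Longrightarrow> K i \<in> hcomponents (delete_edges H F)"
  using bij by (auto simp: bij_betw_def)

lemma K_ends: "i \<in> I \<Longrightarrow> hends (K i) = hends H"
  using component_verts(3)[OF K_component] by (simp add: delete_edges_def)

lemma K_disjoint:
  assumes "i \<in> I" "j \<in> I" "v \<in> hverts (K i)" "v \<in> hverts (K j)"
  shows "i = j"
proof -
  have "K i = K j" using components_disjoint[OF K_component K_component] assms by blast
  then show ?thesis using bij assms(1,2) by (auto simp: bij_betw_def dest: inj_onD)
qed

lemma K_verts: "hverts H = (\<Union>i\<in>I. hverts (K i))"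
proof (intro equalityI subsetI)
  fix v assume "v \<in> hverts H"
  then have "v \<in> hverts (delete_edges H F)" by (simp add: delete_edges_def)
  then obtain L where "L \<in> hcomponents (delete_edges H F)" "v \<in> hverts L"
    using vertex_in_component[OF is_hypergraph_delete] by blast
  moreover from this obtain i where "i \<in> I" "L = K i" using bij by (force simp: bij_betw_def)
  ultimately show "v \<in> (\<Union>i\<in>I. hverts (K i))" by blast
next
  fix v assume "v \<in> (\<Union>i\<in>I. hverts (K i))"
  then show "v \<in> hverts H" using component_verts(1)[OF K_component] by (auto simp: delete_edges_def)
qed

lemma K_edge_iff:
  assumes "i \<in> I" "w \<in> hends H e" "w \<in> hverts (K i)"
  shows "e \<in> hedges (K i) \<longleftrightarrow> e \<in> hedges H - F"
proof
  show "e \<in> hedges H - F" if "e \<in> hedges (K i)"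
    using component_edge_ends(3)[OF K_component[OF assms(1)] that] by (simp add: delete_edges_def)
  show "e \<in> hedges (K i)" if "e \<in> hedges H - F"
    using edge_in_component[OF is_hypergraph_delete K_component[OF assms(1)], of e w] assms(2,3) that
    by (simp add: delete_edges_def)
qed

lemma K_edge_ends:
  assumes "i \<in> I" "e \<in> hedges (K i)"
  shows "hends H e \<subseteq> hverts (K i)" "hends H e \<noteq> {}" "e \<in> hedges H - F"
  using component_edge_ends[OF K_component[OF assms(1)] assms(2)] by (auto simp: delete_edges_def)

definition index :: "'v \<Rightarrow> 'i" where
  "index v = (THE i. i \<in> I \<and> v \<in> hverts (K i))"

lemma index_eq: "\<lbrakk>i \<in> I; v \<in> hverts (K i)\<rbrakk> \<Longrightarrow> index v = i"
  unfolding index_def using K_disjoint by blast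

lemma index_mem:
  assumes "v \<in> hverts H"
  shows "index v \<in> I" "v \<in> hverts (K (index v))"
proof -
  obtain i where "i \<in> I" "v \<in> hverts (K i)" using assms K_verts by blast
  then show "index v \<in> I" "v \<in> hverts (K (index v))" by (simp_all add: index_eq)
qed

lemma finite_I: "finite I"
  using finite_hcomponents[OF is_hypergraph_delete] bij bij_betw_finite by blast

text \<open>An edge that survives the deletion cannot join two components, so a trail changes the index
  of its anchor only at an edge of \<open>F\<close>.\<close>

lemma index_edge:
  assumes "e \<in> hedges H - F" "u \<in> hends H e" "v \<in> hends H e"
  shows "index u = index v"
proof -
  have u: "u \<in> hverts H" using assms hyp by (auto simp: is_hypergraph_def)
  then have "e \<in> hedges (K (index u))"
    using K_edge_iff[OF index_mem(1)[OF u] assms(2)] index_mem(2) assms(1) by simp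
  then have "v \<in> hverts (K (index u))" using K_edge_ends(1) index_mem(1)[OF u] assms(3) by blast
  then show ?thesis using index_eq index_mem(1)[OF u] by simp
qed

end

locale edge_assignment = deleted_edges H F I K
  for H :: "('v, 'e) hypergraph" and F :: "'e set"
    and I :: "'i set" and K :: "'i \<Rightarrow> ('v, 'e) hypergraph" +
  fixes \<alpha> :: "'e \<Rightarrow> 'i set"
  assumes assign: "\<alpha> \<in> F \<rightarrow> unordered_pairs I"
begin

abbreviation "G \<equiv> cut_multigraph I F \<alpha>"
abbreviation "part \<equiv> component_hypergraph H F K \<alpha>"

lemma
  assumes "f \<in> F"
  shows assign_subset: "\<alpha> f \<subseteq> I" and assign_nonempty: "\<alpha> f \<noteq> {}"
proof -
  have "\<alpha> f \<in> unordered_pairs I" using assign assms by (rule funcset_mem)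
  then show "\<alpha> f \<subseteq> I" "\<alpha> f \<noteq> {}" by (auto simp: unordered_pairs_def)
qed

lemma is_hypergraph_G: "is_hypergraph G"
proof -
  have "I \<noteq> {}" using hyp unfolding is_hypergraph_def K_verts by blast
  moreover have "finite F" using F_edges hyp by (auto simp: is_hypergraph_def intro: finite_subset)
  ultimately show ?thesis
    using finite_I assign_subset unfolding is_hypergraph_def cut_multigraph_def by simp
qed

lemma G_component_verts:
  assumes "C \<in> hcomponents G"
  shows "hverts C \<subseteq> I"
  using component_verts(1)[OF assms] by (simp add: cut_multigraph_def)

lemma G_component_of_index:
  assumes "i \<in> I"
  obtains C where "C \<in> hcomponents G" "i \<in> hverts C"
  using vertex_in_component[OF is_hypergraph_G] assms by (auto simp: cut_multigraph_def)

lemma assign_in_component: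
  assumes "C \<in> hcomponents G" "f \<in> F" "i \<in> \<alpha> f" "i \<in> hverts C"
  shows "f \<in> hedges C" "\<alpha> f \<subseteq> hverts C"
proof -
  show "f \<in> hedges C"
    using edge_in_component[OF is_hypergraph_G assms(1), of f i] assms by (simp add: cut_multigraph_def)
  then show "\<alpha> f \<subseteq> hverts C"
    using component_edge_ends(1)[OF assms(1)] by (simp add: cut_multigraph_def)
qed

text \<open>The edges adjoined to form \<open>H(C)\<close> are those with \<open>\<alpha> f\<close> among the edges of \<open>C\<close>. As \<open>C\<close> is a
  component, it is enough that \<open>\<alpha> f\<close> meets \<open>C\<close>, which is the more convenient condition.\<close>

lemma preimage_edges_component:
  assumes "C \<in> hcomponents G"
  shows "preimage_edges F \<alpha> C = {f\<in>F. \<alpha> f \<inter> hverts C \<noteq> {}}"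
proof -
  have "hends C = \<alpha>" using component_verts(3)[OF assms] by (simp add: cut_multigraph_def)
  moreover have "\<alpha> f \<subseteq> hverts C" "\<alpha> f \<noteq> {}" if "f \<in> hedges C" for f
    using component_edge_ends[OF assms that] by (auto simp: cut_multigraph_def)
  moreover have "f \<in> hedges C" if "f \<in> F" "\<alpha> f \<inter> hverts C \<noteq> {}" for f
    using that assign_in_component(1)[OF assms] by blast
  ultimately show ?thesis
    unfolding preimage_edges_def by (intro Collect_cong) blast
qed

lemma verts_part: "hverts (part C) = (\<Union>i\<in>hverts C. hverts (K i))"
  by (simp add: component_hypergraph_def adjoin_edges_def hyper_Union_def)

lemma verts_part_iff:
  assumes "C \<in> hcomponents G" "v \<in> hverts H"
  shows "v \<in> hverts (part C) \<longleftrightarrow> index v \<in> hverts C"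
proof
  assume "v \<in> hverts (part C)"
  then obtain i where i: "i \<in> hverts C" "v \<in> hverts (K i)" by (auto simp: verts_part)
  with G_component_verts[OF assms(1)] have "index v = i" by (intro index_eq) auto
  with i(1) show "index v \<in> hverts C" by simp
next
  assume "index v \<in> hverts C"
  with index_mem(2)[OF assms(2)] show "v \<in> hverts (part C)" by (auto simp: verts_part)
qed

lemma part_verts_subset:
  assumes "C \<in> hcomponents G"
  shows "hverts (part C) \<subseteq> hverts H"
  using G_component_verts[OF assms] by (auto simp: verts_part K_verts)

lemma edges_part:
  assumes "C \<in> hcomponents G"
  shows "hedges (part C) =
    (\<Union>i\<in>hverts C. hedges (K i)) \<union> {f\<in>F. \<alpha> f \<inter> hverts C \<noteq> {}}"
  using preimage_edges_component[OF assms]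
  by (simp add: component_hypergraph_def adjoin_edges_def hyper_Union_def)

lemma part_ends:
  assumes C: "C \<in> hcomponents G" and e: "e \<in> hedges (part C)"
  shows "hends (part C) e = hends H e \<inter> hverts (part C)"
proof (cases "e \<in> F")
  case True
  then have "e \<notin> hedges (K i)" if "i \<in> hverts C" for i
    using that K_edge_ends(3) G_component_verts[OF C] by blast
  then have "e \<in> preimage_edges F \<alpha> C"
    using e by (simp add: edges_part[OF C] preimage_edges_component[OF C])
  then show ?thesis
    by (simp add: verts_part) (simp add: component_hypergraph_def adjoin_edges_def)
next
  case False
  then obtain i where i: "i \<in> hverts C" "e \<in> hedges (K i)" using e edges_part[OF C] by auto
  have I: "hverts C \<subseteq> I" using G_component_verts[OF C] .
  have "hends H e \<subseteq> hverts (part C)"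
    using i I K_edge_ends(1)[of i e] by (auto simp: verts_part)
  moreover have "hends (part C) e = (\<Union>j\<in>{j\<in>hverts C. e \<in> hedges (K j)}. hends (K j) e)"
    using False
    by (simp add: component_hypergraph_def adjoin_edges_def hyper_Union_def preimage_edges_def)
  moreover have "hends (K j) e = hends H e" if "j \<in> hverts C" for j
    using that I K_ends by auto
  then have "(\<Union>j\<in>{j\<in>hverts C. e \<in> hedges (K j)}. hends (K j) e) = hends H e"
    using i by auto
  ultimately show ?thesis by auto
qed

text \<open>That each edge lands in some part uses that no edge is empty: an edge of \<open>H - F\<close> is placed by
  any of its ends, and an edge \<open>f\<close> of \<open>F\<close> by either index in \<open>\<alpha> f\<close>.\<close>

sublocale hypergraph_parts H "hcomponents G" part
proof
  show "finite (hedges H)" using hyp by (simp add: is_hypergraph_def)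
  show "finite (hcomponents G)" using finite_hcomponents is_hypergraph_G .
  show "hverts H = (\<Union>C\<in>hcomponents G. hverts (part C))"
  proof (intro equalityI subsetI)
    fix v assume "v \<in> hverts H"
    moreover from this obtain C where "C \<in> hcomponents G" "index v \<in> hverts C"
      using G_component_of_index[OF index_mem(1)] by blast
    ultimately show "v \<in> (\<Union>C\<in>hcomponents G. hverts (part C))"
      using verts_part_iff by blast
  next
    fix v assume "v \<in> (\<Union>C\<in>hcomponents G. hverts (part C))"
    then show "v \<in> hverts H" using part_verts_subset by blast
  qed
  show "hedges H = (\<Union>C\<in>hcomponents G. hedges (part C))"
  proof (intro equalityI subsetI)
    fix e assume e: "e \<in> hedges H"
    show "e \<in> (\<Union>C\<in>hcomponents G. hedges (part C))"
    proof (cases "e \<in> F")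
      case True
      then obtain i where i: "i \<in> I" "i \<in> \<alpha> e"
        using assign_subset assign_nonempty by blast
      obtain C where "C \<in> hcomponents G" "i \<in> hverts C"
        using G_component_of_index[OF i(1)] .
      with True i show ?thesis using edges_part by blast
    next
      case False
      obtain w where w: "w \<in> hends H e" using e ne by (auto simp: no_empty_edges_def)
      then have "w \<in> hverts H" using e hyp by (auto simp: is_hypergraph_def)
      note i = index_mem[OF this]
      then have "e \<in> hedges (K (index w))" using K_edge_iff w e False by blast
      moreover obtain C where "C \<in> hcomponents G" "index w \<in> hverts C"
        using G_component_of_index[OF i(1)] .
      ultimately show ?thesis using edges_part by blast
    qed
  next
    fix e assume "e \<in> (\<Union>C\<in>hcomponents G. hedges (part C))"
    then obtain C where "C \<in> hcomponents G" "e \<in> hedges (part C)" by blast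
    then show "e \<in> hedges H"
      using edges_part F_edges G_component_verts K_edge_ends(3) by blast
  qed
next
  fix C D v
  assume CD: "C \<in> hcomponents G" "D \<in> hcomponents G"
  {
    assume v: "v \<in> hverts (part C)" "v \<in> hverts (part D)"
    then have "v \<in> hverts H" using CD part_verts_subset by blast
    with CD v have "index v \<in> hverts C" "index v \<in> hverts D" by (simp_all add: verts_part_iff)
    then show "C = D" by (rule components_disjoint[OF CD])
  }
next
  fix C D e
  assume CD: "C \<in> hcomponents G" "D \<in> hcomponents G"
    and e: "e \<in> hedges (part C)" "e \<in> hedges (part D)"
  show "C = D"
  proof (cases "e \<in> F")
    case True
    then obtain i where "i \<in> \<alpha> e" using assign_nonempty by blast
    moreover have "\<alpha> e \<subseteq> hverts B"
      if B: "B \<in> hcomponents G" "e \<in> hedges (part B)" for B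
    proof -
      have "e \<notin> hedges (K j)" if "j \<in> hverts B" for j
        using that True K_edge_ends(3) G_component_verts[OF B(1)] by blast
      then obtain j where "j \<in> \<alpha> e" "j \<in> hverts B"
        using B by (auto simp: edges_part)
      then show ?thesis using assign_in_component(2)[OF B(1) True] by blast
    qed
    ultimately have "i \<in> hverts C" "i \<in> hverts D" using CD e by blast+
    then show ?thesis by (rule components_disjoint[OF CD])
  next
    case False
    then obtain i j where ij: "i \<in> hverts C" "e \<in> hedges (K i)" "j \<in> hverts D" "e \<in> hedges (K j)"
      using e CD edges_part by auto
    then have "i \<in> I" "j \<in> I" using CD G_component_verts by auto
    moreover from this ij obtain w where "w \<in> hverts (K i)" "w \<in> hverts (K j)"
      using K_edge_ends(1,2) by blast
    ultimately have "i = j" using K_disjoint by blast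
    with ij show ?thesis using components_disjoint[OF CD, of i] by simp
  qed
qed (rule part_ends)

text \<open>If \<open>\<alpha>\<close> records the indices of the anchors between which the trail uses each edge of \<open>F\<close>,
  then the indices of consecutive anchors are equal or adjacent in \<open>G\<close>. By induction along the
  trail, all of them lie in the component of the first one.\<close>

lemma trail_in_part:
  assumes walk: "is_walk H T"
    and cross: "\<And>k. \<lbrakk>k < length (snd T); snd T ! k \<in> F\<rbrakk> \<Longrightarrow>
      \<alpha> (snd T ! k) = {index (fst T ! k), index (fst T ! Suc k)}"
  shows "\<exists>C\<in>hcomponents G. anchors T \<subseteq> hverts (part C) \<and> walk_edges T \<subseteq> hedges (part C)"
proof -
  obtain vs es where T: "T = (vs, es)" by fastforce
  have len: "length vs = Suc (length es)" and vs: "set vs \<subseteq> hverts H" and es: "set es \<subseteq> hedges H"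
    and step: "\<And>k. k < length es \<Longrightarrow> vs ! k \<in> hends H (es ! k) \<and> vs ! Suc k \<in> hends H (es ! k)"
    using walk unfolding T is_walk_def by auto
  have vsH: "vs ! k \<in> hverts H" if "k \<le> length es" for k
    using that vs len nth_mem[of k vs] by auto
  obtain C where C: "C \<in> hcomponents G" "index (vs ! 0) \<in> hverts C"
    using G_component_of_index[OF index_mem(1)[OF vsH[of 0]]] by auto
  have inC: "index (vs ! k) \<in> hverts C" if "k \<le> length es" for k
    using that
  proof (induction k)
    case (Suc k)
    show ?case
    proof (cases "es ! k \<in> F")
      case True
      then have "\<alpha> (es ! k) = {index (vs ! k), index (vs ! Suc k)}"
        using cross[of k] Suc.prems by (simp add: T)
      then show ?thesis
        using assign_in_component(2)[OF C(1) True, of "index (vs ! k)"] Suc by simp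
    next
      case False
      then have "index (vs ! k) = index (vs ! Suc k)"
        using step[of k] Suc.prems es nth_mem[of k es] by (intro index_edge[of "es ! k"]) auto
      then show ?thesis using Suc by simp
    qed
  qed (rule C(2))
  have "v \<in> hverts (part C)" if "v \<in> set vs" for v
  proof -
    obtain k where "k \<le> length es" "v = vs ! k"
      using \<open>v \<in> set vs\<close> len by (auto simp: in_set_conv_nth less_Suc_eq_le)
    then show ?thesis using inC vsH verts_part_iff C(1) by simp
  qed
  moreover have "e \<in> hedges (part C)" if "e \<in> set es" for e
  proof -
    obtain k where k: "k < length es" "e = es ! k"
      using \<open>e \<in> set es\<close> by (auto simp: in_set_conv_nth)
    show ?thesis
    proof (cases "e \<in> F")
      case True
      then have "index (vs ! k) \<in> \<alpha> e" using cross[of k] k by (simp add: T)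
      then show ?thesis using True k inC[of k] by (auto simp: edges_part[OF C(1)])
    next
      case False
      have "vs ! k \<in> hverts H" using vsH k by simp
      from index_mem[OF this] have "e \<in> hedges (K (index (vs ! k)))"
        using K_edge_iff step[OF k(1)] that False es k by blast
      then show ?thesis using k inC[of k] by (auto simp: edges_part[OF C(1)])
    qed
  qed
  ultimately show ?thesis using C(1) by (auto simp: T anchors_def walk_edges_def)
qed

end

section \<open>The assignment induced by an Euler family\<close>

context deleted_edges
begin

text \<open>The set is formed over all occurrences of \<open>f\<close> in the family. There is exactly one, so it is
  an unordered pair.\<close>

definition crossing :: "('v, 'e) hwalk set \<Rightarrow> 'e \<Rightarrow> 'i set" where
  "crossing \<F> f = {i. \<exists>T\<in>\<F>. \<exists>k<length (snd T). snd T ! k = f \<and>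
     (i = index (fst T ! k) \<or> i = index (fst T ! Suc k))}"

text \<open>Edge-disjointness of the family fixes the trail that uses an edge, and strictness of the
  trail fixes the position.\<close>

lemma crossing_eq:
  assumes euler: "euler_family H \<F>" and T: "T \<in> \<F>" and k: "k < length (snd T)"
  shows "crossing \<F> (snd T ! k) = {index (fst T ! k), index (fst T ! Suc k)}"
proof -
  have "T' = T \<and> k' = k" if T': "T' \<in> \<F>" "k' < length (snd T')" "snd T' ! k' = snd T ! k" for T' k'
  proof -
    have "snd T ! k \<in> walk_edges T" "snd T ! k \<in> walk_edges T'"
      using nth_mem[OF k] nth_mem[OF T'(2)] T'(3) by (simp_all add: walk_edges_def)
    then have "T' = T" using euler T T'(1) unfolding euler_family_def by blast
    moreover have "distinct (snd T)" using euler T by (auto simp: euler_family_def strict_trail_def)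
    ultimately show ?thesis using T' k by (auto simp: nth_eq_iff_index_eq)
  qed
  then have "crossing \<F> (snd T ! k) = {i. i = index (fst T ! k) \<or> i = index (fst T ! Suc k)}"
    using T k unfolding crossing_def by (intro Collect_cong) metis
  then show ?thesis by auto
qed

lemma crossing_assignment:
  assumes euler: "euler_family H \<F>"
  shows "edge_assignment H F I K (crossing \<F>)"
proof
  show "crossing \<F> \<in> F \<rightarrow> unordered_pairs I"
  proof
    fix f assume "f \<in> F"
    then obtain T where T: "T \<in> \<F>" "f \<in> walk_edges T"
      using euler F_edges unfolding euler_family_def by blast
    then obtain k where k: "k < length (snd T)" "snd T ! k = f"
      by (auto simp: walk_edges_def in_set_conv_nth)
    have "is_walk H T" using euler T by (auto simp: euler_family_def strict_trail_def)
    then have "fst T ! k \<in> hverts H" "fst T ! Suc k \<in> hverts H"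
      using k nth_mem[of k "fst T"] nth_mem[of "Suc k" "fst T"] by (auto simp: is_walk_def split_beta)
    then show "crossing \<F> f \<in> unordered_pairs I"
      using crossing_eq[OF euler T(1) k(1)] k(2) index_mem(1) by (auto simp: unordered_pairs_def)
  qed
qed

lemma euler_family_splits:
  assumes euler: "euler_family H \<F>"
  shows "\<exists>\<alpha>\<in>F \<rightarrow> unordered_pairs I. \<exists>\<G>.
     (\<forall>C\<in>hcomponents (cut_multigraph I F \<alpha>).
        euler_family (component_hypergraph H F K \<alpha> C) (\<G> C) \<and>
        (spanning_euler_family H \<F> \<longrightarrow>
          spanning_euler_family (component_hypergraph H F K \<alpha> C) (\<G> C))) \<and>
     card \<F> = (\<Sum>C\<in>hcomponents (cut_multigraph I F \<alpha>). card (\<G> C))"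
proof -
  interpret edge_assignment H F I K "crossing \<F>" using crossing_assignment[OF euler] .
  have "\<exists>C\<in>hcomponents G. anchors T \<subseteq> hverts (part C) \<and> walk_edges T \<subseteq> hedges (part C)"
    if "T \<in> \<F>" for T
    using euler that crossing_eq
    by (intro trail_in_part) (auto simp: euler_family_def strict_trail_def)
  note facts = euler_family_part[OF euler this] spanning_euler_family_part[OF euler this]
    card_part_trails[OF euler this]
  show ?thesis
    using facts assign by (intro bexI[of _ "crossing \<F>"] exI[of _ "part_trails \<F>"]) auto
qed

end

section \<open>Euler families through a minimal edge cut\<close>

theorem theorem7p4p1:
  fixes H :: "('v, 'e) hypergraph" and F :: "'e set"
    and I :: "'i set" and K :: "'i \<Rightarrow> ('v, 'e) hypergraph"
  assumes "is_hypergraph H" and "hedges H \<noteq> {}" and "hconnected H" and "no_empty_edges H"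
    and "minimal_edge_cut H F"
    and "bij_betw K I (hcomponents (delete_edges H F))"
  shows
    "((\<exists>\<F>. euler_family H \<F>) \<longleftrightarrow>
       (\<exists>\<alpha>\<in>F \<rightarrow> unordered_pairs I. \<forall>C\<in>hcomponents (cut_multigraph I F \<alpha>).
          \<exists>\<F>\<^sub>C. euler_family (component_hypergraph H F K \<alpha> C) \<F>\<^sub>C))
   \<and> ((\<exists>\<F>. spanning_euler_family H \<F>) \<longleftrightarrow>
       (\<exists>\<alpha>\<in>F \<rightarrow> unordered_pairs I. \<forall>C\<in>hcomponents (cut_multigraph I F \<alpha>).
          \<exists>\<F>\<^sub>C. spanning_euler_family (component_hypergraph H F K \<alpha> C) \<F>\<^sub>C))
   \<and> (\<forall>\<F>. euler_family H \<F> \<longrightarrow>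
       (\<exists>\<alpha>\<in>F \<rightarrow> unordered_pairs I. \<exists>\<G>.
          (\<forall>C\<in>hcomponents (cut_multigraph I F \<alpha>).
             euler_family (component_hypergraph H F K \<alpha> C) (\<G> C)) \<and>
          card \<F> = (\<Sum>C\<in>hcomponents (cut_multigraph I F \<alpha>). card (\<G> C))))
   \<and> (\<forall>\<alpha>\<in>F \<rightarrow> unordered_pairs I. \<forall>\<G>.
       (\<forall>C\<in>hcomponents (cut_multigraph I F \<alpha>).
          euler_family (component_hypergraph H F K \<alpha> C) (\<G> C)) \<longrightarrow>
       (\<exists>\<F>. euler_family H \<F> \<and>
          card \<F> = (\<Sum>C\<in>hcomponents (cut_multigraph I F \<alpha>). card (\<G> C))))
   \<and> (\<forall>\<F>. spanning_euler_family H \<F> \<longrightarrow>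
       (\<exists>\<alpha>\<in>F \<rightarrow> unordered_pairs I. \<exists>\<G>.
          (\<forall>C\<in>hcomponents (cut_multigraph I F \<alpha>).
             spanning_euler_family (component_hypergraph H F K \<alpha> C) (\<G> C)) \<and>
          card \<F> = (\<Sum>C\<in>hcomponents (cut_multigraph I F \<alpha>). card (\<G> C))))
   \<and> (\<forall>\<alpha>\<in>F \<rightarrow> unordered_pairs I. \<forall>\<G>.
       (\<forall>C\<in>hcomponents (cut_multigraph I F \<alpha>).
          spanning_euler_family (component_hypergraph H F K \<alpha> C) (\<G> C)) \<longrightarrow>
       (\<exists>\<F>. spanning_euler_family H \<F> \<and>
          card \<F> = (\<Sum>C\<in>hcomponents (cut_multigraph I F \<alpha>). card (\<G> C))))"
proof -
  have "F \<subseteq> hedges H"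
    using assms(5) by (auto simp: minimal_edge_cut_def edge_cut_def cut_edges_def)
  then interpret deleted_edges H F I K
    using assms(1,4,6) by unfold_locales
  have merge: "euler_family H (\<Union>C\<in>hcomponents (cut_multigraph I F \<alpha>). \<G> C)"
      "card (\<Union>C\<in>hcomponents (cut_multigraph I F \<alpha>). \<G> C) =
        (\<Sum>C\<in>hcomponents (cut_multigraph I F \<alpha>). card (\<G> C))"
      "(\<forall>C\<in>hcomponents (cut_multigraph I F \<alpha>).
        spanning_euler_family (component_hypergraph H F K \<alpha> C) (\<G> C)) \<longrightarrow>
        spanning_euler_family H (\<Union>C\<in>hcomponents (cut_multigraph I F \<alpha>). \<G> C)"
    if \<alpha>: "\<alpha> \<in> F \<rightarrow> unordered_pairs I"
      and \<G>: "\<forall>C\<in>hcomponents (cut_multigraph I F \<alpha>).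
        euler_family (component_hypergraph H F K \<alpha> C) (\<G> C)" for \<alpha> \<G>
  proof -
    interpret edge_assignment H F I K \<alpha> by unfold_locales (rule \<alpha>)
    show "euler_family H (\<Union>C\<in>hcomponents G. \<G> C)"
      "card (\<Union>C\<in>hcomponents G. \<G> C) = (\<Sum>C\<in>hcomponents G. card (\<G> C))"
      "(\<forall>C\<in>hcomponents G. spanning_euler_family (part C) (\<G> C)) \<longrightarrow>
        spanning_euler_family H (\<Union>C\<in>hcomponents G. \<G> C)"
      using euler_family_Union[of \<G>] spanning_euler_family_Union[of \<G>] \<G> by blast+
  qed
  have split: "\<exists>\<alpha>\<in>F \<rightarrow> unordered_pairs I. \<exists>\<G>.
          (\<forall>C\<in>hcomponents (cut_multigraph I F \<alpha>).
             euler_family (component_hypergraph H F K \<alpha> C) (\<G> C)) \<and>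
          card \<F> = (\<Sum>C\<in>hcomponents (cut_multigraph I F \<alpha>). card (\<G> C))"
    if "euler_family H \<F>" for \<F>
    using euler_family_splits[OF that] by blast
  have split_spanning: "\<exists>\<alpha>\<in>F \<rightarrow> unordered_pairs I. \<exists>\<G>.
          (\<forall>C\<in>hcomponents (cut_multigraph I F \<alpha>).
             spanning_euler_family (component_hypergraph H F K \<alpha> C) (\<G> C)) \<and>
          card \<F> = (\<Sum>C\<in>hcomponents (cut_multigraph I F \<alpha>). card (\<G> C))"
    if "spanning_euler_family H \<F>" for \<F>
    using euler_family_splits[of \<F>] that unfolding spanning_euler_family_def by blast
  have merge_all: "\<exists>\<F>. euler_family H \<F> \<and>
          card \<F> = (\<Sum>C\<in>hcomponents (cut_multigraph I F \<alpha>). card (\<G> C))"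
    if "\<alpha> \<in> F \<rightarrow> unordered_pairs I"
      and "\<forall>C\<in>hcomponents (cut_multigraph I F \<alpha>).
        euler_family (component_hypergraph H F K \<alpha> C) (\<G> C)" for \<alpha> \<G>
    using merge(1,2)[OF that] by blast
  have merge_spanning: "\<exists>\<F>. spanning_euler_family H \<F> \<and>
          card \<F> = (\<Sum>C\<in>hcomponents (cut_multigraph I F \<alpha>). card (\<G> C))"
    if \<alpha>: "\<alpha> \<in> F \<rightarrow> unordered_pairs I"
      and \<G>: "\<forall>C\<in>hcomponents (cut_multigraph I F \<alpha>).
        spanning_euler_family (component_hypergraph H F K \<alpha> C) (\<G> C)" for \<alpha> \<G>
  proof -
    have "\<forall>C\<in>hcomponents (cut_multigraph I F \<alpha>).
        euler_family (component_hypergraph H F K \<alpha> C) (\<G> C)"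
      using \<G> by (simp add: spanning_euler_family_def)
    from merge(2,3)[OF \<alpha> this] \<G> show ?thesis by blast
  qed
  have euler_iff: "(\<exists>\<F>. euler_family H \<F>) \<longleftrightarrow>
       (\<exists>\<alpha>\<in>F \<rightarrow> unordered_pairs I. \<forall>C\<in>hcomponents (cut_multigraph I F \<alpha>).
          \<exists>\<F>\<^sub>C. euler_family (component_hypergraph H F K \<alpha> C) \<F>\<^sub>C)" (is "_ \<longleftrightarrow> ?R")
  proof
    assume "\<exists>\<F>. euler_family H \<F>"
    then show ?R using split by blast
  next
    assume ?R
    then obtain \<alpha> where \<alpha>: "\<alpha> \<in> F \<rightarrow> unordered_pairs I" "\<forall>C\<in>hcomponents (cut_multigraph I F \<alpha>).
          \<exists>\<F>\<^sub>C. euler_family (component_hypergraph H F K \<alpha> C) \<F>\<^sub>C" ..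
    then show "\<exists>\<F>. euler_family H \<F>" using merge_all[OF \<alpha>(1)] bchoice[OF \<alpha>(2)] by blast
  qed
  have spanning_iff: "(\<exists>\<F>. spanning_euler_family H \<F>) \<longleftrightarrow>
       (\<exists>\<alpha>\<in>F \<rightarrow> unordered_pairs I. \<forall>C\<in>hcomponents (cut_multigraph I F \<alpha>).
          \<exists>\<F>\<^sub>C. spanning_euler_family (component_hypergraph H F K \<alpha> C) \<F>\<^sub>C)" (is "_ \<longleftrightarrow> ?R")
  proof
    assume "\<exists>\<F>. spanning_euler_family H \<F>"
    then show ?R using split_spanning by blast
  next
    assume ?R
    then obtain \<alpha> where \<alpha>: "\<alpha> \<in> F \<rightarrow> unordered_pairs I" "\<forall>C\<in>hcomponents (cut_multigraph I F \<alpha>).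
          \<exists>\<F>\<^sub>C. spanning_euler_family (component_hypergraph H F K \<alpha> C) \<F>\<^sub>C" ..
    then show "\<exists>\<F>. spanning_euler_family H \<F>" using merge_spanning[OF \<alpha>(1)] bchoice[OF \<alpha>(2)] by blast
  qed
  show ?thesis
    by (intro conjI euler_iff spanning_iff allI ballI impI split split_spanning merge_all
        merge_spanning) blast+
qed

end
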